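(* Let $n>1$ be an integer. Then the following two identities hold (as identities of rational functions in the independent variables $x,y$; equivalently, for all complex numbers $x\neq y$): $$\sum_{k=1}^{n-1}\frac{B_k(x)B_{n-k}(y)}{k(n-k)}-\sum_{l=1}^{n}\binom{n-1}{l-1}\frac{B_l(x-y)B_{n-l}(y)+B_l(y-x)B_{n-l}(x)}{l^2}=\frac{H_{n-1}}{n}\bigl(B_n(x)+B_n(y)\bigr)+\frac{B_n(x)-B_n(y)}{n(x-y)}$$ and $$\sum_{k=0}^nB_k(x)B_{n-k}(y)-\sum_{l=0}^n\binom{n+1}{l+1}\frac{B_l(x-y)B_{n-l}(y)+B_l(y-x)B_{n-l}(x)}{l+2}=\frac{B_{n+1}(x)+B_{n+1}(y)}{(x-y)^2}-\frac{2}{n+2}\cdot\frac{B_{n+2}(x)-B_{n+2}(y)}{(x-y)^3}.$$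
   Context: The Bernoulli numbers $B_0,B_1,\ldots$ are defined by $\frac{z}{e^z-1}=\sum_{n=0}^{\infty}B_n\frac{z^n}{n!}$ for $|z|<2\pi$ (so $B_1=-1/2$). The Bernoulli polynomials are $B_n(x)=\sum_{k=0}^n\binom{n}{k}B_kx^{n-k}$ for $n=0,1,2,\ldots$. For a positive integer $n$, $H_n=1+\frac12+\cdots+\frac1n$. *)

theory Defs
  imports "HOL-Complex_Analysis.Complex_Analysis"
begin

text \<open>
  The quotient below is the formal power series of \<open>z / (e\<^sup>z - 1)\<close>: both series have
  vanishing constant term, and division of formal power series cancels the common factor \<open>z\<close>.
  That the resulting numbers are the coefficients of the convergent expansion on
  \<open>|z| < 2\<pi>\<close> is shown in \<open>bernoulli_sums\<close>.
\<close>

definition bernoulli :: "nat \<Rightarrow> complex" where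
  "bernoulli n = fact n * fps_nth (fps_X / (fps_exp 1 - 1)) n"

definition bernpoly :: "nat \<Rightarrow> complex \<Rightarrow> complex" where
  "bernpoly n x = (\<Sum>k=0..n. of_nat (n choose k) * bernoulli k * x ^ (n - k))"

lemma bernoulli_sums:
  fixes z :: complex
  assumes "norm z < 2 * pi"
  shows "(\<lambda>n. bernoulli n * z ^ n / fact n) sums (if z = 0 then 1 else z / (exp z - 1))"
proof -
  let ?G = "fps_exp 1 - 1 :: complex fps"
  let ?f = "\<lambda>z::complex. if z = 0 then 1 else z / (exp z - 1)"
  have G0: "fps_nth ?G 0 = 0" and G1: "fps_nth ?G 1 = 1" by auto
  have G: "?G \<noteq> 0" using G1 by (metis fps_zero_nth zero_neq_one)
  have sd: "subdegree ?G = 1"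
    by (rule subdegreeI) (use G0 G1 in auto)
  have expand: "?f has_fps_expansion (fps_X / ?G)"
  proof (rule has_fps_expansion_divide)
    show "(\<lambda>z::complex. z) has_fps_expansion fps_X"
      by (rule has_fps_expansion_fps_X)
    show "(\<lambda>z::complex. exp z - 1) has_fps_expansion ?G"
      using has_fps_expansion_diff[OF has_fps_expansion_exp[of "1::complex"] has_fps_expansion_1]
      by simp
  qed (use G sd G1 in auto)
  have nz: "exp w \<noteq> 1" if "norm w < 2 * pi" "w \<noteq> 0" for w :: complex
  proof
    assume "exp w = 1"
    then have "exp w = exp 0" by simp
    moreover have "\<bar>Im w - Im 0\<bar> < 2 * pi"
      using abs_Im_le_cmod[of w] that(1) by simp
    ultimately show False using exp_complex_eqI[of w 0] that(2) by blast
  qed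
  have holo: "?f holomorphic_on ball 0 (2 * pi)"
  proof (rule no_isolated_singularity[of _ _ "{0}"])
    have "?f holomorphic_on (ball 0 (2 * pi) - {0})
        \<longleftrightarrow> (\<lambda>z. z / (exp z - 1)) holomorphic_on (ball 0 (2 * pi) - {0})"
      by (rule holomorphic_cong) auto
    also have "\<dots>"
      by (intro holomorphic_intros) (use nz in auto)
    finally show off0: "?f holomorphic_on (ball 0 (2 * pi) - {0})" .
    have "continuous_on (ball 0 (2 * pi) - {0}) ?f"
      by (rule holomorphic_on_imp_continuous_on[OF off0])
    then have "isCont ?f w" if "w \<in> ball 0 (2 * pi) - {0}" for w
      using that by (subst (asm) continuous_on_eq_continuous_at) (auto simp: open_Diff)
    moreover have "isCont ?f 0"
      using has_fps_expansion_imp_continuous[OF expand, of UNIV] by simp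
    ultimately show "continuous_on (ball 0 (2 * pi)) ?f"
      by (intro continuous_at_imp_continuous_on) blast
  qed auto
  have "(\<lambda>n. fps_nth (fps_X / ?G) n * z ^ n) sums ?f z"
    by (rule has_fps_expansion_imp_sums_complex[OF expand, of "ereal (2 * pi)"])
       (use holo assms in auto)
  then show ?thesis by (simp add: bernoulli_def)
qed

end

theory Submission
  imports Defs
begin

text \<open>
  Both identities come from one polynomial identity in an auxiliary variable \<open>t\<close>. Put
  \<open>a = e\<^bsup>tz\<^esup>\<close> and \<open>b = e\<^bsup>(1-t)z\<^esup>\<close>, so that \<open>ab = e\<^bsup>z\<^esup>\<close>. Dividing
  \<open>ab - 1 = (a - 1) + (b - 1) + (a - 1)(b - 1)\<close> by \<open>(a - 1)(b - 1)(ab - 1)\<close> writes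
  \<open>1/((a - 1)(b - 1))\<close> as \<open>1/(ab - 1)\<close> times \<open>1 + 1/(a - 1) + 1/(b - 1)\<close>. Multiplied by
  \<open>t(1 - t) z\<^sup>2\<close> and by the exponential of \<open>z(tx + (1 - t)y)\<close>, this expresses the product of the
  exponential generating functions of \<open>B\<^sub>k(x) t\<^sup>k\<close> and \<open>B\<^sub>k(y) (1 - t)\<^sup>k\<close> through the product of
  those of \<open>B\<^sub>l(x - y) t\<^sup>l\<close> and \<open>B\<^sub>m(y)\<close> and the product of those of \<open>B\<^sub>l(y - x) (1 - t)\<^sup>l\<close> and
  \<open>B\<^sub>m(x)\<close> (\<open>bernpoly_fps_product\<close>). The coefficient of \<open>z\<^sup>n\<close> is the identity
  \<open>bernpoly_product_identity\<close>, whose last term is a multiple of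
  \<open>t(1 - t) B\<^bsub>n-1\<^esub>(y + (x - y)t)\<close>.

  Integrate this over \<open>t \<in> [0, 1]\<close>. The Beta integral of \<open>t\<^sup>k (1 - t)\<^bsup>n-k\<^esup>\<close> is
  \<open>k! (n - k)! / (n + 1)!\<close>, which cancels the denominators \<open>k! (n - k)!\<close> on the left once both
  sides are multiplied by \<open>(n + 1)!\<close>. Integrating by parts twice in the last term, with \<open>B\<^sub>m' = m B\<^bsub>m-1\<^esub>\<close>, gives the right-hand side of the second identity.
  For the first identity divide by \<open>t(1 - t)\<close> before integrating. The summands \<open>k = 0\<close>,
  \<open>k = n\<close> and \<open>l = 0\<close> then have poles at the end points, which cancel and leave the geometric
  sums \<open>(1 - s\<^bsup>n-1\<^esup>)/(1 - s)\<close> with \<open>s = t\<close> and \<open>s = 1 - t\<close>; these integrate to the harmonic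
  number \<open>H\<^bsub>n-1\<^esub>\<close>, and the integral of \<open>B\<^bsub>n-1\<^esub>(y + (x - y)t)\<close> is the difference quotient.
\<close>

section \<open>Products of generating functions\<close>

text \<open>
  The exponential generating function of \<open>n \<mapsto> B\<^sub>n(x) c\<^sup>n\<close>, that is, the expansion in \<open>z\<close> of
  \<open>c z e\<^bsup>cxz\<^esup> / (e\<^bsup>cz\<^esup> - 1)\<close> for \<open>c \<noteq> 0\<close>. It is given by its coefficients, so that the
  division is replaced by the relation \<open>bernpoly_fps_mult\<close>, valid for every \<open>c\<close>.
\<close>

definition bernpoly_fps :: "complex \<Rightarrow> complex \<Rightarrow> complex fps" where
  "bernpoly_fps x c = Abs_fps (\<lambda>n. bernpoly n x / fact n * c ^ n)"

lemma bernpoly_div_fact: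
  "bernpoly n x / fact n = fps_nth (fps_X / (fps_exp 1 - 1) * fps_exp x) n"
  by (auto simp: bernpoly_def fps_mult_nth sum_divide_distrib binomial_fact bernoulli_def
      intro!: sum.cong)

lemma fps_exp_minus_1_nonzero: "c \<noteq> 0 \<Longrightarrow> fps_exp c - 1 \<noteq> (0 :: complex fps)"
proof
  assume c: "c \<noteq> 0" and "fps_exp c - 1 = 0"
  then have "fps_nth (fps_exp c - 1) 1 = 0" by simp
  with c show False by simp
qed

lemma bernpoly_fps_mult:
  "bernpoly_fps x c * (fps_exp c - 1) = fps_const c * fps_X * fps_exp (c * x)"
proof -
  let ?E = "fps_exp 1 - 1 :: complex fps" and ?l = "fps_const c * fps_X"
  have sd: "subdegree ?E = 1" by (rule subdegreeI) auto
  have "?E dvd fps_X"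
    using sd fps_exp_minus_1_nonzero[of 1] by (subst fps_dvd_iff) auto
  then have X: "fps_X / ?E * ?E = fps_X" by simp
  have eq: "bernpoly_fps x c = (fps_X / ?E * fps_exp x) oo ?l"
    by (rule fps_ext)
      (simp add: bernpoly_fps_def bernpoly_div_fact fps_nth_compose_linear mult.commute[of _ "c ^ _"])
  have E: "fps_exp c - 1 = ?E oo ?l"
    by (simp add: fps_compose_sub_distrib fps_exp_compose_linear)
  have "bernpoly_fps x c * (fps_exp c - 1) = (fps_X / ?E * fps_exp x * ?E) oo ?l"
    unfolding eq E by (rule fps_compose_mult_distrib[symmetric]) simp
  also have "fps_X / ?E * fps_exp x * ?E = fps_X * fps_exp x"
    using X by (simp add: mult_ac)
  also have "\<dots> oo ?l = ?l * fps_exp (c * x)"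
    by (simp add: fps_compose_mult_distrib fps_exp_compose_linear)
  finally show ?thesis .
qed

lemma bernpoly_fps_product:
  assumes t: "t \<noteq> 0" "t \<noteq> 1"
  shows "bernpoly_fps x t * bernpoly_fps y (1 - t) =
      fps_const (1 - t) * (bernpoly_fps (x - y) t * bernpoly_fps y 1)
    + fps_const t * (bernpoly_fps (y - x) (1 - t) * bernpoly_fps x 1)
    + fps_const (t * (1 - t)) * (fps_X * bernpoly_fps (y + (x - y) * t) 1)"
    (is "?L = ?R")
proof -
  define a b where "a = fps_exp t" and "b = fps_exp (1 - t)"
  define u v where "u = a - 1" and "v = b - 1"
  define w where "w = fps_exp (1 :: complex) - 1"
  define e where "e = fps_exp (t * x + (1 - t) * y)"
  have ab: "a * b = fps_exp 1"
    by (simp add: a_def b_def flip: fps_exp_add_mult)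
  have w: "w = u + v + u * v"
    unfolding w_def u_def v_def ab[symmetric] by (simp add: algebra_simps)
  have nz: "u * v * w \<noteq> 0"
    using t by (simp add: u_def v_def w_def a_def b_def fps_exp_minus_1_nonzero)
  define P Q S R S' R' W where "P = bernpoly_fps x t" and "Q = bernpoly_fps y (1 - t)"
    and "S = bernpoly_fps (x - y) t" and "R = bernpoly_fps y 1"
    and "S' = bernpoly_fps (y - x) (1 - t)" and "R' = bernpoly_fps x 1"
    and "W = bernpoly_fps (y + (x - y) * t) 1"
  define k l where "k = fps_const t" and "l = fps_const (1 - t)"
  have u: "bernpoly_fps z t * u = k * fps_X * fps_exp (t * z)" for z
    by (simp add: bernpoly_fps_mult u_def a_def k_def)
  have v: "bernpoly_fps z (1 - t) * v = l * fps_X * fps_exp ((1 - t) * z)" for z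
    by (simp add: bernpoly_fps_mult v_def b_def l_def)
  have w': "bernpoly_fps z 1 * w = fps_X * fps_exp z" for z
    by (simp add: bernpoly_fps_mult w_def)
  have PQ: "(P * u) * (Q * v) = k * l * fps_X\<^sup>2 * e"
    unfolding P_def Q_def u v e_def by (simp add: fps_exp_add_mult power2_eq_square mult_ac)
  have SR: "(S * u) * (R * w) = k * fps_X\<^sup>2 * e"
  proof -
    have "fps_exp (t * (x - y)) * fps_exp y = e"
      by (simp add: e_def algebra_simps flip: fps_exp_add_mult)
    then show ?thesis
      unfolding S_def R_def u w' by (simp add: power2_eq_square mult_ac)
  qed
  have SR': "(S' * v) * (R' * w) = l * fps_X\<^sup>2 * e"
  proof -
    have "fps_exp ((1 - t) * (y - x)) * fps_exp x = e"
      by (simp add: e_def algebra_simps flip: fps_exp_add_mult)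
    then show ?thesis
      unfolding S'_def R'_def v w' by (simp add: power2_eq_square mult_ac)
  qed
  have W: "W * w = fps_X * e"
    unfolding W_def w' e_def by (simp add: algebra_simps)
  have kl: "fps_const (t * (1 - t)) = k * l"
    by (simp add: k_def l_def)
  \<comment> \<open>Once the denominators are cleared, both sides reduce to the relation \<open>w = u + v + u * v\<close>
    multiplied by the same factor.\<close>
  have "(u * v * w) * ?L = ((P * u) * (Q * v)) * w"
    by (simp add: P_def Q_def algebra_simps)
  also have "\<dots> = l * v * ((S * u) * (R * w)) + k * u * ((S' * v) * (R' * w))
      + k * l * fps_X * u * v * (W * w)"
    unfolding PQ SR SR' W by (simp add: w algebra_simps power2_eq_square)
  also have "\<dots> = (u * v * w) * ?R"
    unfolding kl k_def[symmetric] l_def[symmetric]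
      S_def[symmetric] R_def[symmetric] S'_def[symmetric] R'_def[symmetric] W_def[symmetric]
    by algebra
  finally show ?thesis
    using nz by simp
qed

lemma bernpoly_fps_nth: "fps_nth (bernpoly_fps x c) n = bernpoly n x / fact n * c ^ n"
  by (simp add: bernpoly_fps_def)

lemma bernpoly_fps_mult_nth:
  "fps_nth (bernpoly_fps x c * bernpoly_fps y d) n =
     (\<Sum>k=0..n. bernpoly k x * bernpoly (n - k) y / (fact k * fact (n - k)) * (c ^ k * d ^ (n - k)))"
  by (auto simp: fps_mult_nth bernpoly_fps_nth intro!: sum.cong)

text \<open>
  Cancelling the denominators requires \<open>t \<noteq> 0\<close> and \<open>t \<noteq> 1\<close>. By continuity the identity extends
  to these two values, but for integration over \<open>[0, 1]\<close> a null set does not matter.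
\<close>

lemma bernpoly_product_identity:
  assumes "t \<noteq> 0" "t \<noteq> 1" "n > 0"
  shows "(\<Sum>k=0..n. bernpoly k x * bernpoly (n - k) y / (fact k * fact (n - k)) * (t ^ k * (1 - t) ^ (n - k)))
    = (1 - t) * (\<Sum>l=0..n. bernpoly l (x - y) * bernpoly (n - l) y / (fact l * fact (n - l)) * t ^ l)
    + t * (\<Sum>l=0..n. bernpoly l (y - x) * bernpoly (n - l) x / (fact l * fact (n - l)) * (1 - t) ^ l)
    + t * (1 - t) * (bernpoly (n - 1) (y + (x - y) * t) / fact (n - 1))"
proof -
  note arg_cong[OF bernpoly_fps_product[OF assms(1,2), of x y], of "\<lambda>f. fps_nth f n"]
  then show ?thesis
    using assms(3) by (simp add: bernpoly_fps_mult_nth bernpoly_fps_nth)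
qed

section \<open>The divided product identity\<close>

lemma bernoulli_0: "bernoulli 0 = 1"
  using bernoulli_sums[of 0] powser_sums_zero_iff[of "\<lambda>n. bernoulli n / fact n" 1] by simp

lemma bernpoly_0: "bernpoly 0 x = 1"
  by (simp add: bernpoly_def bernoulli_0)

text \<open>
  This is \<open>bernpoly_product_identity\<close> divided by \<open>t(1 - t)\<close>, where the summands with \<open>k = 0\<close>,
  \<open>k = n\<close> and \<open>l = 0\<close> are combined into geometric sums, so that no poles remain.
\<close>

lemma bernpoly_product_identity_divided:
  assumes t: "t \<noteq> 0" "t \<noteq> 1" and n: "n > 1"
  shows "(\<Sum>k=1..n-1. bernpoly k x * bernpoly (n - k) y / (fact k * fact (n - k))
        * (t ^ (k - 1) * (1 - t) ^ (n - k - 1)))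
    = (\<Sum>l=1..n. bernpoly l (x - y) * bernpoly (n - l) y / (fact l * fact (n - l)) * t ^ (l - 1))
    + (\<Sum>l=1..n. bernpoly l (y - x) * bernpoly (n - l) x / (fact l * fact (n - l)) * (1 - t) ^ (l - 1))
    + bernpoly n y / fact n * (\<Sum>j<n-1. (1 - t) ^ j) + bernpoly n x / fact n * (\<Sum>j<n-1. t ^ j)
    + bernpoly (n - 1) (y + (x - y) * t) / fact (n - 1)"
    (is "?L = ?D + ?E + ?Y * ?q + ?X * ?p + ?W")
proof -
  define C where "C k = bernpoly k x * bernpoly (n - k) y / (fact k * fact (n - k))" for k
  define D where "D l = bernpoly l (x - y) * bernpoly (n - l) y / (fact l * fact (n - l))" for l
  define E where "E l = bernpoly l (y - x) * bernpoly (n - l) x / (fact l * fact (n - l))" for l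
  have C: "(\<Sum>k=0..n. C k * (t ^ k * (1 - t) ^ (n - k)))
      = ?Y * (1 - t) ^ n + ?X * t ^ n + t * (1 - t) * ?L"
  proof -
    have "{0..n} = insert 0 (insert n {1..n-1})"
      using n by auto
    moreover have "(\<Sum>k=1..n-1. C k * (t ^ k * (1 - t) ^ (n - k))) = t * (1 - t) * ?L"
      unfolding sum_distrib_left
    proof (rule sum.cong)
      fix k assume k: "k \<in> {1..n-1}"
      then have "k = Suc (k - 1)" and "n - k = Suc (n - k - 1)"
        by auto
      then obtain i j where "k = Suc i" "n - k = Suc j"
        by blast
      then show "C k * (t ^ k * (1 - t) ^ (n - k)) =
          t * (1 - t) * (bernpoly k x * bernpoly (n - k) y / (fact k * fact (n - k))
             * (t ^ (k - 1) * (1 - t) ^ (n - k - 1)))"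
        by (simp add: C_def)
    qed simp
    moreover have "C 0 = ?Y" "C n = ?X"
      by (simp_all add: C_def bernpoly_0)
    ultimately show ?thesis
      using n by simp
  qed
  have split: "(\<Sum>l=0..n. F l * s ^ l) = F 0 + s * (\<Sum>l=1..n. F l * s ^ (l - 1))"
    for F and s :: complex
  proof -
    have "F l * s ^ l = s * (F l * s ^ (l - 1))" if "l \<in> {1..n}" for l
      using that by (cases l) simp_all
    then have "(\<Sum>l=1..n. F l * s ^ l) = s * (\<Sum>l=1..n. F l * s ^ (l - 1))"
      unfolding sum_distrib_left by (rule sum.cong[OF refl])
    then show ?thesis
      by (simp add: sum.atLeast_Suc_atMost)
  qed
  have geo: "s - s ^ n = s * (1 - s) * (\<Sum>j<n-1. s ^ j)" for s :: complex
  proof -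
    have "s - s ^ n = s * (1 - s ^ (n - 1))"
      using n by (simp add: right_diff_distrib flip: power_Suc)
    then show ?thesis
      by (simp add: one_diff_power_eq)
  qed
  have D0: "D 0 = ?Y" and E0: "E 0 = ?X"
    by (simp_all add: D_def E_def bernpoly_0)
  have "?Y * (1 - t) ^ n + ?X * t ^ n + t * (1 - t) * ?L
     = (1 - t) * (?Y + t * ?D) + t * (?X + (1 - t) * ?E) + t * (1 - t) * ?W"
    using bernpoly_product_identity[OF t, of n x y, folded C_def D_def E_def] n
    unfolding split D0 E0 C by (simp add: D_def E_def)
  moreover have "t * (1 - t) * L = t * (1 - t) * (D + E + W) + Y * ((1 - t) - P) + X * (t - Q)"
    if "Y * P + X * Q + t * (1 - t) * L
      = (1 - t) * (Y + t * D) + t * (X + (1 - t) * E) + t * (1 - t) * W"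
    for L D E W X Y P Q :: complex
    using that by algebra
  ultimately have "t * (1 - t) * ?L = t * (1 - t) * (?D + ?E + ?W)
      + ?Y * ((1 - t) - (1 - t) ^ n) + ?X * (t - t ^ n)"
    by blast
  also have "\<dots> = t * (1 - t) * (?D + ?E + ?Y * ?q + ?X * ?p + ?W)"
  proof -
    have "t * (1 - t) * (D + E + W) + Y * ((1 - t) * (1 - (1 - t)) * Q) + X * (t * (1 - t) * P)
        = t * (1 - t) * (D + E + Y * Q + X * P + W)" for D E W X Y P Q :: complex
      by algebra
    then show ?thesis
      unfolding geo by blast
  qed
  finally show ?thesis
    using t by simp
qed

section \<open>Integrals of Bernoulli polynomials over the unit interval\<close>

lemma has_field_derivative_bernpoly:
  "(bernpoly (Suc n) has_field_derivative of_nat (Suc n) * bernpoly n x) (at x within S)"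
proof -
  have "((\<lambda>x. \<Sum>k=0..Suc n. of_nat (Suc n choose k) * bernoulli k * x ^ (Suc n - k))
     has_field_derivative (\<Sum>k=0..Suc n. of_nat (Suc n choose k) * bernoulli k *
        (of_nat (Suc n - k) * x ^ (n - k)))) (at x within S)"
    by (auto intro!: derivative_eq_intros sum.cong)
  moreover have "(\<Sum>k=0..Suc n. of_nat (Suc n choose k) * bernoulli k *
        (of_nat (Suc n - k) * x ^ (n - k))) = of_nat (Suc n) * bernpoly n x"
  proof -
    have absorb: "of_nat (Suc n choose k) * of_nat (Suc n - k)
        = (of_nat (Suc n) * of_nat (n choose k) :: complex)" for k
      unfolding of_nat_mult[symmetric] by (subst mult.commute, subst binomial_absorb_comp) simp
    have "of_nat (Suc n choose k) * bernoulli k * (of_nat (Suc n - k) * x ^ (n - k))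
        = of_nat (Suc n choose k) * of_nat (Suc n - k) * (bernoulli k * x ^ (n - k))" for k
      by (simp only: mult_ac)
    then have "of_nat (Suc n choose k) * bernoulli k * (of_nat (Suc n - k) * x ^ (n - k))
        = of_nat (Suc n) * (of_nat (n choose k) * bernoulli k * x ^ (n - k))" for k
      by (simp only: absorb mult.assoc)
    then have "(\<Sum>k=0..Suc n. of_nat (Suc n choose k) * bernoulli k *
          (of_nat (Suc n - k) * x ^ (n - k)))
        = (\<Sum>k=0..Suc n. of_nat (Suc n) * (of_nat (n choose k) * bernoulli k * x ^ (n - k)))"
      by (simp only:)
    also have "\<dots> = of_nat (Suc n) * bernpoly n x"
      by (simp add: bernpoly_def sum_distrib_left del: of_nat_Suc)
    finally show ?thesis .
  qed
  ultimately show ?thesis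
    by (simp add: bernpoly_def[abs_def])
qed

lemma has_integral_powers_unit:
  "((\<lambda>t. of_real t ^ k * (1 - of_real t) ^ m) has_integral
     (fact k * fact m / fact (k + m + 1) :: complex)) {0..1}"
proof -
  have "((\<lambda>t. t powr (real (k + 1) - 1) * (1 - t) powr (real (m + 1) - 1)) has_integral
      Beta (real (k + 1)) (real (m + 1))) {0..1}"
    by (rule has_integral_Beta_real) auto
  also have "Beta (real (k + 1)) (real (m + 1)) = fact k * fact m / fact (k + m + 1)"
    using Gamma_fact[of k, where 'a = real] Gamma_fact[of m, where 'a = real]
      Gamma_fact[of "k + m + 1", where 'a = real]
    by (simp add: Beta_def add_ac del: fact_Suc)
  \<comment> \<open>At the end points \<open>0 powr 0 = 0\<close> differs from \<open>0 ^ 0 = 1\<close>.\<close>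
  finally have "((\<lambda>t. t ^ k * (1 - t) ^ m) has_integral
      (fact k * fact m / fact (k + m + 1) :: real)) {0..1}"
    by (rule has_integral_spike_finite[of "{0, 1}", rotated 2]) (auto simp: powr_realpow)
  from has_integral_of_real[OF this, where 'b = complex] show ?thesis by simp
qed

lemma bernpoly_segment_derivative:
  assumes "x \<noteq> y"
  shows "((\<lambda>t. bernpoly (Suc n) (y + (x - y) * of_real t) / (of_nat (Suc n) * (x - y)))
    has_vector_derivative bernpoly n (y + (x - y) * of_real t)) (at t within S)"
proof -
  have "((\<lambda>u. bernpoly (Suc n) (y + (x - y) * u) / (of_nat (Suc n) * (x - y)))
    has_field_derivative bernpoly n (y + (x - y) * of_real t)) (at (of_real t))"
    using assms
    by (auto intro!: derivative_eq_intros DERIV_chain2[OF has_field_derivative_bernpoly]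
        simp del: of_nat_Suc)
  from has_vector_derivative_real_field[OF this] show ?thesis .
qed

lemma has_integral_bernpoly_segment:
  assumes "x \<noteq> y"
  shows "((\<lambda>t. bernpoly n (y + (x - y) * of_real t)) has_integral
    (bernpoly (Suc n) x - bernpoly (Suc n) y) / (of_nat (Suc n) * (x - y))) {0..1}"
  using fundamental_theorem_of_calculus[OF _ bernpoly_segment_derivative[OF assms], of 0 1 n]
  by (simp add: diff_divide_distrib)

lemma has_integral_weighted_bernpoly_segment:
  fixes x y :: complex
  assumes "x \<noteq> y"
  shows "((\<lambda>t. of_real t * (1 - of_real t) * bernpoly n (y + (x - y) * of_real t)) has_integral
    (bernpoly (n + 2) x + bernpoly (n + 2) y) / (of_nat (n + 1) * of_nat (n + 2) * (x - y) ^ 2)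
    - 2 * (bernpoly (n + 3) x - bernpoly (n + 3) y)
        / (of_nat (n + 1) * of_nat (n + 2) * of_nat (n + 3) * (x - y) ^ 3)) {0..1}"
proof -
  \<comment> \<open>\<open>F j\<close> is a \<open>j\<close>-fold iterated antiderivative of \<open>t \<mapsto> B\<^sub>n(y + (x - y)t)\<close>, and \<open>\<Phi>\<close> is the
    antiderivative of the integrand that integration by parts produces.\<close>
  define F where "F j t = fact n * bernpoly (n + j) (y + (x - y) * of_real t)
      / (fact (n + j) * (x - y) ^ j)" for j and t :: real
  have F: "(F (Suc j) has_vector_derivative F j t) (at t within {0..1})" for j t
  proof -
    have "F (Suc j) = (\<lambda>t. fact n / (fact (n + j) * (x - y) ^ j) *
        (bernpoly (Suc (n + j)) (y + (x - y) * of_real t) / (of_nat (Suc (n + j)) * (x - y))))"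
      by (simp add: F_def fun_eq_iff mult_ac del: of_nat_Suc)
    moreover have "((\<lambda>t. fact n / (fact (n + j) * (x - y) ^ j) *
        (bernpoly (Suc (n + j)) (y + (x - y) * of_real t) / (of_nat (Suc (n + j)) * (x - y))))
        has_vector_derivative fact n / (fact (n + j) * (x - y) ^ j) *
          bernpoly (n + j) (y + (x - y) * of_real t)) (at t within {0..1})"
      by (intro has_vector_derivative_mult_right bernpoly_segment_derivative assms)
    ultimately show ?thesis
      by (simp only: F_def) simp
  qed
  define \<Phi> where "\<Phi> t = of_real t * (1 - of_real t) * F 1 t - (1 - 2 * of_real t) * F 2 t - 2 * F 3 t"
    for t :: real
  have "(\<Phi> has_vector_derivative of_real t * (1 - of_real t) * F 0 t) (at t within {0..1})" for t
  proof -
    have "(F 1 has_vector_derivative F 0 t) (at t within {0..1})"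
      "(F 2 has_vector_derivative F 1 t) (at t within {0..1})"
      "(F 3 has_vector_derivative F 2 t) (at t within {0..1})"
      using F[of 0] F[of 1] F[of 2] by (simp_all add: eval_nat_numeral)
    moreover have "(of_real has_vector_derivative (1 :: complex)) (at t within {0..1})"
      using has_vector_derivative_of_real[OF DERIV_ident] by simp
    ultimately show ?thesis
      unfolding \<Phi>_def[abs_def]
      by - (rule has_vector_derivative_eq_rhs,
          (rule has_vector_derivative_diff has_vector_derivative_mult has_vector_derivative_const
            | assumption)+, simp add: algebra_simps)
  qed
  then have "((\<lambda>t. of_real t * (1 - of_real t) * F 0 t) has_integral \<Phi> 1 - \<Phi> 0) {0..1}"
    by (intro fundamental_theorem_of_calculus) auto
  moreover have "\<Phi> 1 - \<Phi> 0 = F 2 1 + F 2 0 - 2 * (F 3 1 - F 3 0)"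
    by (simp add: \<Phi>_def)
  ultimately show ?thesis
    by (simp add: F_def add_divide_distrib diff_divide_distrib eval_nat_numeral mult_ac)
qed

section \<open>Integration of the product identities\<close>

lemma has_integral_sum_powers_unit:
  assumes "finite A"
  shows "((\<lambda>t. \<Sum>k\<in>A. C k * (of_real t ^ f k * (1 - of_real t) ^ g k)) has_integral
     (\<Sum>k\<in>A. C k * (fact (f k) * fact (g k) / fact (f k + g k + 1) :: complex))) {0..1}"
  by (intro has_integral_sum has_integral_mult_right has_integral_powers_unit assms)

text \<open>
  In both proofs below, \<open>?l\<close> and \<open>?r\<close> are the two sides of the product identity, in the second
  proof of the divided one, as functions of \<open>t\<close>. Every summand of a sum is written as a multiple
  of \<open>t\<^sup>i (1 - t)\<^sup>j\<close>, if necessary with a trivial exponent, so that \<open>has_integral_sum_powers_unit\<close>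
  applies to it.
\<close>

lemma sum_bernpoly_mult_bernpoly:
  fixes n :: nat and x y :: complex
  assumes "n > 0" and "x \<noteq> y"
  shows "(\<Sum>k=0..n. bernpoly k x * bernpoly (n - k) y)
         - (\<Sum>l=0..n. of_nat ((n + 1) choose (l + 1)) *
              ((bernpoly l (x - y) * bernpoly (n - l) y + bernpoly l (y - x) * bernpoly (n - l) x)
                / of_nat (l + 2)))
         = (bernpoly (n + 1) x + bernpoly (n + 1) y) / (x - y) ^ 2
           - 2 / of_nat (n + 2) * ((bernpoly (n + 2) x - bernpoly (n + 2) y) / (x - y) ^ 3)"
proof -
  obtain m where n: "n = Suc m"
    using assms(1) gr0_implies_Suc by blast
  define C where "C k = bernpoly k x * bernpoly (n - k) y / (fact k * fact (n - k))" for k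
  define D where "D l = bernpoly l (x - y) * bernpoly (n - l) y / (fact l * fact (n - l))" for l
  define E where "E l = bernpoly l (y - x) * bernpoly (n - l) x / (fact l * fact (n - l))" for l
  define W where "W = (bernpoly (n + 1) x + bernpoly (n + 1) y) / (of_nat n * of_nat (n + 1) * (x - y) ^ 2)
    - 2 * (bernpoly (n + 2) x - bernpoly (n + 2) y) / (of_nat n * of_nat (n + 1) * of_nat (n + 2) * (x - y) ^ 3)"
  let ?l = "\<lambda>t. \<Sum>k=0..n. C k * (complex_of_real t ^ k * (1 - of_real t) ^ (n - k))"
  let ?r = "\<lambda>t. (\<Sum>l=0..n. D l * (complex_of_real t ^ l * (1 - of_real t) ^ 1))
      + (\<Sum>l=0..n. E l * (of_real t ^ 1 * (1 - of_real t) ^ l))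
      + of_real t * (1 - of_real t) * bernpoly (n - 1) (y + (x - y) * of_real t) * (1 / fact (n - 1))"
  let ?R = "(\<Sum>l=0..n. D l * (fact l * fact 1 / fact (l + 1 + 1)))
    + (\<Sum>l=0..n. E l * (fact 1 * fact l / fact (1 + l + 1))) + W * (1 / fact (n - 1))"
  have W: "((\<lambda>t. of_real t * (1 - of_real t) * bernpoly (n - 1) (y + (x - y) * of_real t))
      has_integral W) {0..1}"
    using has_integral_weighted_bernpoly_segment[OF assms(2), of m]
    by (simp add: n W_def eval_nat_numeral)
  have eq: "?r t = ?l t" if "t \<in> {0..1} - {0, 1}" for t :: real
    using that assms(1) bernpoly_product_identity[of "of_real t" n x y]
    by (simp add: C_def D_def E_def sum_distrib_left mult_ac)
  have "(?l has_integral (\<Sum>k=0..n. C k * (fact k * fact (n - k) / fact (k + (n - k) + 1)))) {0..1}"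
    by (intro has_integral_sum_powers_unit) simp
  then have "(?r has_integral (\<Sum>k=0..n. C k * (fact k * fact (n - k) / fact (k + (n - k) + 1)))) {0..1}"
    by (rule has_integral_spike_finite[of "{0, 1}", rotated 2]) (use eq in auto)
  moreover have "(?r has_integral ?R) {0..1}"
    by (intro has_integral_add has_integral_sum_powers_unit has_integral_mult_left W) simp_all
  ultimately have "(\<Sum>k=0..n. C k * (fact k * fact (n - k) / fact (k + (n - k) + 1))) = ?R"
    by (rule has_integral_unique)
  then have "fact (n + 1) * (\<Sum>k=0..n. C k * (fact k * fact (n - k) / fact (k + (n - k) + 1)))
      = fact (n + 1) * ?R"
    by (rule arg_cong)
  moreover have "fact (n + 1) * (\<Sum>k=0..n. C k * (fact k * fact (n - k) / fact (k + (n - k) + 1)))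
      = (\<Sum>k=0..n. bernpoly k x * bernpoly (n - k) y)"
    unfolding sum_distrib_left by (rule sum.cong) (simp_all add: C_def del: fact_Suc)
  moreover have "fact (n + 1) * (\<Sum>l=0..n. D l * (fact l * fact 1 / fact (l + 1 + 1)))
      + fact (n + 1) * (\<Sum>l=0..n. E l * (fact 1 * fact l / fact (1 + l + 1)))
     = (\<Sum>l=0..n. of_nat ((n + 1) choose (l + 1)) *
              ((bernpoly l (x - y) * bernpoly (n - l) y + bernpoly l (y - x) * bernpoly (n - l) x)
                / of_nat (l + 2)))"
    unfolding sum_distrib_left sum.distrib[symmetric]
  proof (rule sum.cong)
    fix l assume l: "l \<in> {0..n}"
    have "(of_nat ((n + 1) choose (l + 1)) :: complex) = fact (n + 1) / (fact (l + 1) * fact (n - l))"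
      using l by (subst binomial_fact) auto
    moreover have "(fact (l + 2) :: complex) = of_nat (l + 2) * fact (l + 1)"
      by (simp add: algebra_simps)
    ultimately show "fact (n + 1) * (D l * (fact l * fact 1 / fact (l + 1 + 1)))
      + fact (n + 1) * (E l * (fact 1 * fact l / fact (1 + l + 1))) =
      of_nat ((n + 1) choose (l + 1)) *
              ((bernpoly l (x - y) * bernpoly (n - l) y + bernpoly l (y - x) * bernpoly (n - l) x)
                / of_nat (l + 2))"
      by (simp add: D_def E_def add_divide_distrib distrib_left mult_ac del: fact_Suc of_nat_Suc of_nat_add)
  qed simp
  moreover have "fact (n + 1) * (W * (1 / fact (n - 1))) =
     (bernpoly (n + 1) x + bernpoly (n + 1) y) / (x - y) ^ 2
           - 2 / of_nat (n + 2) * ((bernpoly (n + 2) x - bernpoly (n + 2) y) / (x - y) ^ 3)"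
  proof -
    define c :: complex where "c = of_nat n * of_nat (n + 1)"
    have f: "fact (n + 1) = c * fact (n - 1)"
      by (simp add: c_def n algebra_simps)
    have "c \<noteq> 0"
      unfolding c_def mult_eq_0_iff of_nat_eq_0_iff using assms(1) by simp
    moreover have "W = 1 / c * ((bernpoly (n + 1) x + bernpoly (n + 1) y) / (x - y) ^ 2
           - 2 / of_nat (n + 2) * ((bernpoly (n + 2) x - bernpoly (n + 2) y) / (x - y) ^ 3))"
    proof -
      have "a / (c * d) - 2 * b / (c * e * f) = 1 / c * (a / d - 2 / e * (b / f))"
        for a b d e f :: complex
        by (simp add: right_diff_distrib mult.assoc)
      then show ?thesis
        unfolding W_def c_def by blast
    qed
    moreover have "c * fact (n - 1) * (W * (1 / fact (n - 1))) = c * W"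
      by simp
    ultimately show ?thesis
      unfolding f by (simp only: mult.assoc[symmetric]) simp
  qed
  ultimately show ?thesis
    by (simp only: distrib_left) (simp only: add_diff_cancel_left')
qed

lemma sum_bernpoly_mult_bernpoly_div:
  fixes n :: nat and x y :: complex
  assumes n: "n > 1" and "x \<noteq> y"
  shows "(\<Sum>k=1..n-1. bernpoly k x * bernpoly (n - k) y / (of_nat k * of_nat (n - k)))
         - (\<Sum>l=1..n. of_nat ((n - 1) choose (l - 1)) *
              ((bernpoly l (x - y) * bernpoly (n - l) y + bernpoly l (y - x) * bernpoly (n - l) x)
                / of_nat l ^ 2))
         = harm (n - 1) / of_nat n * (bernpoly n x + bernpoly n y)
           + (bernpoly n x - bernpoly n y) / (of_nat n * (x - y))"
proof -
  define C where "C k = bernpoly k x * bernpoly (n - k) y / (fact k * fact (n - k))" for k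
  define D where "D l = bernpoly l (x - y) * bernpoly (n - l) y / (fact l * fact (n - l))" for l
  define E where "E l = bernpoly l (y - x) * bernpoly (n - l) x / (fact l * fact (n - l))" for l
  define X Y where "X = bernpoly n x / fact n" and "Y = bernpoly n y / fact n"
  define W where "W = (bernpoly n x - bernpoly n y) / (of_nat n * (x - y))"
  let ?l = "\<lambda>t. \<Sum>k=1..n-1. C k * (complex_of_real t ^ (k - 1) * (1 - of_real t) ^ (n - k - 1))"
  let ?r = "\<lambda>t. (\<Sum>l=1..n. D l * (complex_of_real t ^ (l - 1) * (1 - of_real t) ^ 0))
      + (\<Sum>l=1..n. E l * (of_real t ^ 0 * (1 - of_real t) ^ (l - 1)))
      + ((\<Sum>j<n-1. Y * (of_real t ^ 0 * (1 - of_real t) ^ j))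
        + (\<Sum>j<n-1. X * (of_real t ^ j * (1 - of_real t) ^ 0)))
      + bernpoly (n - 1) (y + (x - y) * of_real t) * (1 / fact (n - 1))"
  let ?L = "\<Sum>k=1..n-1. C k * (fact (k - 1) * fact (n - k - 1) / fact ((k - 1) + (n - k - 1) + 1))"
  let ?R = "(\<Sum>l=1..n. D l * (fact (l - 1) * fact 0 / fact ((l - 1) + 0 + 1)))
      + (\<Sum>l=1..n. E l * (fact 0 * fact (l - 1) / fact (0 + (l - 1) + 1)))
      + ((\<Sum>j<n-1. Y * (fact 0 * fact j / fact (0 + j + 1)))
        + (\<Sum>j<n-1. X * (fact j * fact 0 / fact (j + 0 + 1))))
      + W * (1 / fact (n - 1))"
  have W: "((\<lambda>t. bernpoly (n - 1) (y + (x - y) * of_real t)) has_integral W) {0..1}"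
    using has_integral_bernpoly_segment[OF assms(2), of "n - 1"] n by (simp add: W_def)
  have eq: "?r t = ?l t" if "t \<in> {0..1} - {0, 1}" for t :: real
    using that n bernpoly_product_identity_divided[of "of_real t" n x y]
    by (simp add: C_def D_def E_def X_def Y_def sum_distrib_left)
  have "(?l has_integral ?L) {0..1}"
    by (intro has_integral_sum_powers_unit) simp
  then have "(?r has_integral ?L) {0..1}"
    by (rule has_integral_spike_finite[of "{0, 1}", rotated 2]) (use eq in auto)
  moreover have "(?r has_integral ?R) {0..1}"
    by (intro has_integral_add has_integral_sum_powers_unit has_integral_mult_left W) simp_all
  ultimately have "?L = ?R"
    by (rule has_integral_unique)
  then have "fact (n - 1) * ?L = fact (n - 1) * ?R"
    by (rule arg_cong)
  moreover have "fact (n - 1) * ?L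
      = (\<Sum>k=1..n-1. bernpoly k x * bernpoly (n - k) y / (of_nat k * of_nat (n - k)))"
    unfolding sum_distrib_left
  proof (rule sum.cong)
    fix k assume k: "k \<in> {1..n-1}"
    then have "k - 1 + (n - k - 1) + 1 = n - 1" and "k > 0" and "n - k > 0"
      by auto
    then show "fact (n - 1) * (C k * (fact (k - 1) * fact (n - k - 1) / fact (k - 1 + (n - k - 1) + 1)))
        = bernpoly k x * bernpoly (n - k) y / (of_nat k * of_nat (n - k))"
      by (simp only: C_def fact_reduce[of k] fact_reduce[of "n - k"]) simp
  qed simp
  moreover have "fact (n - 1) * (\<Sum>l=1..n. D l * (fact (l - 1) * fact 0 / fact ((l - 1) + 0 + 1)))
      + fact (n - 1) * (\<Sum>l=1..n. E l * (fact 0 * fact (l - 1) / fact (0 + (l - 1) + 1)))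
      = (\<Sum>l=1..n. of_nat ((n - 1) choose (l - 1)) *
              ((bernpoly l (x - y) * bernpoly (n - l) y + bernpoly l (y - x) * bernpoly (n - l) x)
                / of_nat l ^ 2))"
    unfolding sum_distrib_left sum.distrib[symmetric]
  proof (rule sum.cong)
    fix l assume "l \<in> {1..n}"
    then obtain i where l: "l = Suc i" "i \<le> n - 1" "n - 1 - i = n - l"
      by (cases l) auto
    have "(of_nat ((n - 1) choose (l - 1)) :: complex) = fact (n - 1) / (fact i * fact (n - l))"
      using l by (simp add: binomial_fact)
    moreover have "(fact l :: complex) = of_nat l * fact i"
      by (simp add: l)
    ultimately show "fact (n - 1) * (D l * (fact (l - 1) * fact 0 / fact (l - 1 + 0 + 1)))
      + fact (n - 1) * (E l * (fact 0 * fact (l - 1) / fact (0 + (l - 1) + 1))) =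
      of_nat ((n - 1) choose (l - 1)) *
              ((bernpoly l (x - y) * bernpoly (n - l) y + bernpoly l (y - x) * bernpoly (n - l) x)
                / of_nat l ^ 2)"
      by (simp add: D_def E_def l(1) add_divide_distrib distrib_left power2_eq_square mult_ac
          del: fact_Suc of_nat_Suc)
  qed simp
  moreover have "fact (n - 1) * (\<Sum>j<n-1. Y * (fact 0 * fact j / fact (0 + j + 1)))
      + fact (n - 1) * (\<Sum>j<n-1. X * (fact j * fact 0 / fact (j + 0 + 1)))
      = harm (n - 1) / of_nat n * (bernpoly n x + bernpoly n y)"
  proof -
    have "(\<Sum>j<n-1. Z * (fact j / fact (Suc j))) = Z * harm (n - 1)" for Z :: complex
    proof -
      have "(\<Sum>j<n-1. fact j / fact (Suc j)) = (\<Sum>j<n-1. inverse (of_nat (Suc j)) :: complex)"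
        by (intro sum.cong) (simp_all add: field_simps del: of_nat_Suc)
      also have "\<dots> = harm (n - 1)"
        unfolding harm_def
        by (rule sum.reindex_bij_witness[of _ "\<lambda>k. k - 1" Suc]) auto
      finally show ?thesis
        by (simp only: sum_distrib_left[symmetric])
    qed
    moreover have "fact (n - 1) * X = bernpoly n x / of_nat n" "fact (n - 1) * Y = bernpoly n y / of_nat n"
      using n by (simp_all add: X_def Y_def fact_reduce[of n])
    ultimately show ?thesis
      by (simp add: add_divide_distrib distrib_left mult_ac flip: mult.assoc del: fact_Suc)
  qed
  moreover have "fact (n - 1) * (W * (1 / fact (n - 1))) = W"
    by simp
  ultimately show ?thesis
    unfolding W_def[symmetric] by (simp only: distrib_left) (simp only: add.assoc add_diff_cancel_left')
qed

theorem theorem1p1: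
  fixes n :: nat and x y :: complex
  assumes "n > 1" and "x \<noteq> y"
  shows "((\<Sum>k=1..n-1. bernpoly k x * bernpoly (n - k) y / (of_nat k * of_nat (n - k)))
         - (\<Sum>l=1..n. of_nat ((n - 1) choose (l - 1)) *
              ((bernpoly l (x - y) * bernpoly (n - l) y + bernpoly l (y - x) * bernpoly (n - l) x)
                / of_nat l ^ 2))
         = harm (n - 1) / of_nat n * (bernpoly n x + bernpoly n y)
           + (bernpoly n x - bernpoly n y) / (of_nat n * (x - y)))
    \<and> ((\<Sum>k=0..n. bernpoly k x * bernpoly (n - k) y)
         - (\<Sum>l=0..n. of_nat ((n + 1) choose (l + 1)) *
              ((bernpoly l (x - y) * bernpoly (n - l) y + bernpoly l (y - x) * bernpoly (n - l) x)
                / of_nat (l + 2)))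
         = (bernpoly (n + 1) x + bernpoly (n + 1) y) / (x - y) ^ 2
           - 2 / of_nat (n + 2) * ((bernpoly (n + 2) x - bernpoly (n + 2) y) / (x - y) ^ 3))"
  using sum_bernpoly_mult_bernpoly_div[OF assms] sum_bernpoly_mult_bernpoly[of n, OF _ assms(2)] assms(1)
  by (intro conjI) simp_all

end
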